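(* Let $n\ge 1$ and let $0<\varepsilon<1$ be real. For every input sequence $\sigma=(e_1,\dots,e_m)$ of items with additive valuations $v_i(e_j)\in[0,1]$ ($i\in N=\{1,\dots,n\}$), the online deterministic algorithm $\mathcal{A}_\varepsilon$ (defined in the context) returns an allocation $A=(A_1,\dots,A_n)$ of $M=\{e_1,\dots,e_m\}$ such that $$v_i(A_i)\;\ge\;\frac{1-\varepsilon}{n}\,v_i(M)-\frac{(n!)^2}{\varepsilon^{n}}\qquad\text{for all } i\in N .$$
   Context: Setting (online max-min fair allocation). There are agents $N=\{1,\dots,n\}$ and items $M=\{e_1,\dots,e_m\}$ arriving one by one. Agent $i$ values item $e$ at $v_i(e)\in[0,1]$, and $v_i(X)=\sum_{e\in X}v_i(e)$ for $X\subseteq M$. On arrival of $e_j$ its value vector $(v_1(e_j),\dots,v_n(e_j))$ is revealed and $e_j$ must be given irrevocably to one agent; $m$ is not known in advance. An allocation is a partition $(A_1,\dots,A_n)$ of $M$ (parts may be empty). For fixed $\varepsilon\in(0,1)$, put $\mathrm{ind}(x)=\lfloor\log_{1-\varepsilon}x\rfloor$ for $x\in(0,1]$ and $\mathrm{ind}(0)=\infty$. Algorithm $\mathcal{A}_\varepsilon$. Start with $A_i=\emptyset$ for all $i$. The algorithm keeps integer counters $x(\tau;w_1,\dots,w_i)$ indexed by a permutation $\tau$ of $N$ and a finite sequence $(w_1,\dots,w_i)$ with $1\le i\le n$; each counter is initially $0$. When item $e_j$ arrives: (1) Let $\tau^j$ be a permutation of $N$ with $v_{\tau^j(1)}(e_j)\ge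 v_{\tau^j(2)}(e_j)\ge\dots\ge v_{\tau^j(n)}(e_j)$ (ties broken arbitrarily), and let $w^j_i=\mathrm{ind}(v_{\tau^j(i)}(e_j))$ for $i=1,\dots,n$. (2) For $i=n,n-1,\dots,1$ in this order: increase $x(\tau^j;w^j_1,\dots,w^j_i)$ by $1$; if now $x(\tau^j;w^j_1,\dots,w^j_i)=i$, then allocate $e_j$ to agent $\tau^j(i)$ (add it to $A_{\tau^j(i)}$), reset $x(\tau^j;w^j_1,\dots,w^j_i)$ to $0$, and stop processing $e_j$ (go to the next item). (For $i=1$ the test always succeeds, so every item is allocated.) *)

theory Defs
  imports Complex_Main
    "HOL-Library.Extended"
    "HOL-Library.Disjoint_Sets"
    "HOL-Combinatorics.Permutations"
begin

text \<open>
  Agents are the numbers 1, ..., n. A valuation profile is a function \<open>v\<close>, where \<open>v i e\<close> is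
  the value of agent \<open>i\<close> for item \<open>e\<close>.
\<close>

definition bundle_value :: "('e \<Rightarrow> real) \<Rightarrow> 'e set \<Rightarrow> real" where
  "bundle_value u X = (\<Sum>e\<in>X. u e)"

definition allocation :: "nat \<Rightarrow> 'e set \<Rightarrow> (nat \<Rightarrow> 'e set) \<Rightarrow> bool" where
  "allocation n M A \<longleftrightarrow> disjoint_family_on A {1..n} \<and> (\<Union>i\<in>{1..n}. A i) = M"

text \<open>Only used for \<open>0 \<le> x \<le> 1\<close>; \<open>Pinf\<close> is the value \<open>\<infinity>\<close>.\<close>

definition ind :: "real \<Rightarrow> real \<Rightarrow> int extended" where
  "ind \<epsilon> x = (if x = 0 then Pinf else Fin \<lfloor>log (1 - \<epsilon>) x\<rfloor>)"

definition sorts :: "nat \<Rightarrow> (nat \<Rightarrow> real) \<Rightarrow> (nat \<Rightarrow> nat) \<Rightarrow> bool" where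
  "sorts n u \<tau> \<longleftrightarrow> \<tau> permutes {1..n} \<and> (\<forall>i\<in>{1..n}. \<forall>j\<in>{1..n}. i \<le> j \<longrightarrow> u (\<tau> j) \<le> u (\<tau> i))"

text \<open>
  An arbitrary way of breaking ties: a rule that selects a sorting permutation from the nonempty
  list of all value vectors revealed so far, whose last entry is the vector of the current item.
  Being allowed to depend on the whole history, such a rule can break the ties at different
  arrivals independently of each other, even if the value vectors coincide.
\<close>

definition tie_breaking :: "nat \<Rightarrow> ((nat \<Rightarrow> real) list \<Rightarrow> nat \<Rightarrow> nat) \<Rightarrow> bool" where
  "tie_breaking n tb \<longleftrightarrow>
     (\<forall>us. us \<noteq> [] \<and> (\<forall>i\<in>{1..n}. 0 \<le> last us i \<and> last us i \<le> 1) \<longrightarrow> sorts n (last us) (tb us))"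

type_synonym counters = "(nat \<Rightarrow> nat) \<times> int extended list \<Rightarrow> nat"

text \<open>
  The inner loop, for the indices \<open>i, i - 1, ..., 1\<close>. It returns the updated counters and the agent
  that receives the item (\<open>None\<close> if the loop were to end without allocating it).
\<close>

fun place :: "(nat \<Rightarrow> nat) \<Rightarrow> int extended list \<Rightarrow> nat \<Rightarrow> counters \<Rightarrow> counters \<times> nat option" where
  "place \<tau> w 0 x = (x, None)"
| "place \<tau> w (Suc k) x =
     (let i = Suc k; key = (\<tau>, take i w); c = x key + 1
      in if c = i then (x(key := 0), Some (\<tau> i)) else place \<tau> w k (x(key := c)))"

type_synonym 'e state = "counters \<times> (nat \<Rightarrow> 'e set)"

definition step ::
  "nat \<Rightarrow> real \<Rightarrow> (nat \<Rightarrow> 'e \<Rightarrow> real) \<Rightarrow> (nat \<Rightarrow> nat) \<Rightarrow> 'e \<Rightarrow> 'e state \<Rightarrow> 'e state" where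
  "step n \<epsilon> v \<tau> e s =
     (let (x, A) = s;
          w = map (\<lambda>i. ind \<epsilon> (v (\<tau> i) e)) [1..<Suc n];
          (x', a) = place \<tau> w n x
      in (x', case a of None \<Rightarrow> A | Some i \<Rightarrow> A(i := insert e (A i))))"

text \<open>\<open>state_after n \<epsilon> tb v es j\<close> is the state after the first \<open>j\<close> items of \<open>es\<close>.\<close>

primrec state_after ::
  "nat \<Rightarrow> real \<Rightarrow> ((nat \<Rightarrow> real) list \<Rightarrow> nat \<Rightarrow> nat) \<Rightarrow> (nat \<Rightarrow> 'e \<Rightarrow> real) \<Rightarrow> 'e list \<Rightarrow> nat \<Rightarrow> 'e state"
where
  "state_after n \<epsilon> tb v es 0 = ((\<lambda>_. 0), (\<lambda>_. {}))"
| "state_after n \<epsilon> tb v es (Suc j) =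
     step n \<epsilon> v (tb (map (\<lambda>e i. v i e) (take (Suc j) es))) (es ! j) (state_after n \<epsilon> tb v es j)"

definition alg ::
  "nat \<Rightarrow> real \<Rightarrow> ((nat \<Rightarrow> real) list \<Rightarrow> nat \<Rightarrow> nat) \<Rightarrow> (nat \<Rightarrow> 'e \<Rightarrow> real) \<Rightarrow> 'e list \<Rightarrow> nat \<Rightarrow> 'e set"
where
  "alg n \<epsilon> tb v es = snd (state_after n \<epsilon> tb v es (length es))"

end

theory Submission
  imports Defs
begin

text \<open>
  Fix an agent \<open>a\<close> and group the items by the sorting permutation \<open>\<tau>\<close> and the first \<open>k\<close> indices, where
  \<open>k\<close> is the position of \<open>a\<close> in \<open>\<tau>\<close>. Since level \<open>l\<close> gives away every \<open>l\<close>-th item that reaches it, at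
  least \<open>k T / n\<close> of the \<open>T\<close> items of a group reach level \<open>k\<close>, and \<open>a\<close> receives at least \<open>T / n - 1\<close>
  of them. Up to the factor \<open>1 - \<epsilon>\<close>, all items of the group have the value \<open>(1 - \<epsilon>) ^ c\<close> for \<open>a\<close>, where
  \<open>c\<close> is the last index of the group. The index sequences are nondecreasing, so summing these
  values over all sequences of length \<open>k\<close> gives \<open>1 / \<epsilon> ^ k\<close>, and the total loss is at most
  \<open>n! / \<epsilon> ^ n\<close>.
\<close>

section \<open>The inner loop, the counters, and the share of items reaching each level\<close>

text \<open>The loop descends from level \<open>K\<close> and stops at the first level
  \<open>l\<close> whose counter is one short of \<open>l\<close>; under the invariant in the
  premise the level 1 counter is 0, so a stop always occurs. Levels above \<open>l\<close> have only
  been incremented, and levels below \<open>l\<close> are untouched.\<close>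

lemma place_cases:
  assumes "0 < K" "K \<le> length w" "\<forall>i\<in>{1..K}. x (\<tau>, take i w) < i"
  shows "\<exists>l\<in>{1..K}. x (\<tau>, take l w) + 1 = l \<and> (\<forall>i\<in>{l<..K}. x (\<tau>, take i w) + 1 < i) \<and>
    place \<tau> w K x =
      ((\<lambda>q. if q = (\<tau>, take l w) then 0
            else if q \<in> (\<lambda>i. (\<tau>, take i w)) ` {l<..K} then x q + 1 else x q), Some (\<tau> l))"
  using assms
proof (induction K arbitrary: x)
  case 0
  then show ?case by simp
next
  case (Suc K)
  let ?key = "(\<tau>, take (Suc K) w)"
  show ?case
  proof (cases "x ?key = K")
    case True
    then show ?thesis
      by (intro bexI[of _ "Suc K"]) (auto simp: Let_def fun_upd_def)
  next
    case False
    have less: "x ?key < Suc K" using Suc.prems(3) by simp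
    with False have K: "0 < K" by simp
    let ?y = "x(?key := x ?key + 1)"
    \<comment> \<open>Since \<open>w\<close> has at least \<open>Suc K\<close> entries, its prefixes
      of different lengths differ. Incrementing the counter of this level therefore leaves those of
      all lower levels unchanged.\<close>
    have key_neq: "(\<tau>, take i w) \<noteq> ?key" if "i \<le> K" for i
    proof
      assume "(\<tau>, take i w) = ?key"
      then have "length (take i w) = length (take (Suc K) w)" by simp
      with that Suc.prems(2) show False by simp
    qed
    have y: "?y (\<tau>, take i w) = x (\<tau>, take i w)" if "i \<le> K" for i
      using key_neq[OF that] by simp
    have y_less: "\<forall>i\<in>{1..K}. ?y (\<tau>, take i w) < i"
      using y Suc.prems(3) by simp
    have "K \<le> length w" using Suc.prems(2) by simp
    from Suc.IH[OF K this y_less] obtain l where l: "l \<in> {1..K}"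
      and l1: "?y (\<tau>, take l w) + 1 = l"
      and l2: "\<forall>i\<in>{l<..K}. ?y (\<tau>, take i w) + 1 < i"
      and l3: "place \<tau> w K ?y = ((\<lambda>q. if q = (\<tau>, take l w) then 0
            else if q \<in> (\<lambda>i. (\<tau>, take i w)) ` {l<..K} then ?y q + 1 else ?y q), Some (\<tau> l))"
      by (elim bexE conjE) (rule that)
    have split: "{l<..Suc K} = insert (Suc K) {l<..K}" using l by auto
    have "place \<tau> w (Suc K) x = place \<tau> w K ?y" using False by (simp add: Let_def)
    moreover have "(\<lambda>q. if q = (\<tau>, take l w) then 0
            else if q \<in> (\<lambda>i. (\<tau>, take i w)) ` {l<..K} then ?y q + 1 else ?y q) =
          (\<lambda>q. if q = (\<tau>, take l w) then 0
            else if q \<in> (\<lambda>i. (\<tau>, take i w)) ` {l<..Suc K} then x q + 1 else x q)"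
      (is "?f = ?g")
    proof
      fix q
      show "?f q = ?g q"
      proof (cases "q = ?key")
        case True
        have "q \<notin> (\<lambda>i. (\<tau>, take i w)) ` {l<..K}"
        proof
          assume "q \<in> (\<lambda>i. (\<tau>, take i w)) ` {l<..K}"
          then show False using key_neq True by (elim imageE) (metis greaterThanAtMost_iff)
        qed
        moreover have "q \<noteq> (\<tau>, take l w)" using key_neq[of l] l True by (metis atLeastAtMost_iff)
        ultimately show ?thesis using True unfolding split by simp
      next
        case False
        then show ?thesis unfolding split by simp
      qed
    qed
    moreover have "x (\<tau>, take i w) + 1 < i" if "i \<in> {l<..Suc K}" for i
    proof (cases "i = Suc K")
      case True
      then show ?thesis using \<open>x ?key \<noteq> K\<close> less by simp
    next
      case False
      with that have "i \<in> {l<..K}" "i \<le> K" by auto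
      then show ?thesis using l2 y[of i] by (metis (no_types, lifting))
    qed
    ultimately show ?thesis
      using l l1 y[of l] l3 by (intro bexI[of _ l]) (simp_all del: place.simps)
  qed
qed

lemma card_less_Suc_if:
  "card {i. i < Suc j \<and> P i} = card {i. i < j \<and> P i} + (if P j then 1 else 0)"
proof -
  have "{i. i < Suc j \<and> P i} = (if P j then insert j {i. i < j \<and> P i} else {i. i < j \<and> P i})"
    by (auto simp: less_Suc_eq)
  then show ?thesis by simp
qed

text \<open>This replaces the counters by pure counting: \<open>lev j\<close> is the level at which
  item \<open>j\<close> is given away, and an item meets its counter at level
  \<open>length p\<close> iff \<open>lev j \<le> length p\<close>. Every \<open>length p\<close>
  such items with the same key make one round, in which exactly one is given away there. No bound on
  \<open>j\<close> is needed, as the recursion is defined beyond the end of the list too.\<close>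

lemma state_after_levels:
  fixes n :: nat and v :: "nat \<Rightarrow> 'e \<Rightarrow> real" and \<tau> :: "nat \<Rightarrow> nat \<Rightarrow> nat"
  assumes \<tau>: "\<And>j. \<tau> j = tb (map (\<lambda>e i. v i e) (take (Suc j) es))"
    and w: "\<And>j. w j = map (\<lambda>i. ind \<epsilon> (v (\<tau> j i) (es ! j))) [1..<Suc n]"
    and n: "n \<ge> 1"
  obtains lev where "\<And>j. lev j \<in> {1..n}"
    and "\<And>j a. snd (state_after n \<epsilon> tb v es j) a = (!) es ` {i. i < j \<and> \<tau> i (lev i) = a}"
    and "\<And>j t p. p \<noteq> [] \<Longrightarrow>
      card {i. i < j \<and> \<tau> i = t \<and> take (length p) (w i) = p \<and> lev i = length p} =
      card {i. i < j \<and> \<tau> i = t \<and> take (length p) (w i) = p \<and> lev i \<le> length p} div length p"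
proof -
  define s where "s = state_after n \<epsilon> tb v es"
  have len: "length (w j) = n" for j by (simp add: w)
  have s0: "s 0 = ((\<lambda>_. 0), (\<lambda>_. {}))" by (simp add: s_def)
  have sSuc: "s (Suc j) = (let (x', a) = place (\<tau> j) (w j) n (fst (s j))
      in (x', case a of None \<Rightarrow> snd (s j)
          | Some i \<Rightarrow> (snd (s j))(i := insert (es ! j) (snd (s j) i))))" for j
    unfolding s_def by (simp add: w \<tau> step_def split_beta Let_def del: upt_Suc)
  let ?new = "\<lambda>j l q. if q = (\<tau> j, take l (w j)) then 0
            else if q \<in> (\<lambda>i. (\<tau> j, take i (w j))) ` {l<..n} then fst (s j) q + 1 else fst (s j) q"
  let ?step = "\<lambda>j l. l \<in> {1..n} \<and> fst (s j) (\<tau> j, take l (w j)) + 1 = l \<and>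
     (\<forall>i\<in>{l<..n}. fst (s j) (\<tau> j, take i (w j)) + 1 < i) \<and>
     s (Suc j) = (?new j l, (snd (s j))(\<tau> j l := insert (es ! j) (snd (s j) (\<tau> j l))))"
  \<comment> \<open>The counter bound is a premise here because its own proof by induction, in
    \<open>bound\<close>, uses this step.\<close>
  have step: "\<exists>l. ?step j l" if "\<And>t p. p \<noteq> [] \<Longrightarrow> fst (s j) (t, p) < length p" for j
  proof -
    have "fst (s j) (\<tau> j, take i (w j)) < i" if "i \<in> {1..n}" for i
    proof -
      have "take i (w j) \<noteq> []" using that len[of j] n by auto
      then have "fst (s j) (\<tau> j, take i (w j)) < length (take i (w j))" by fact
      then show ?thesis using that len[of j] by simp
    qed
    then have "\<forall>i\<in>{1..n}. fst (s j) (\<tau> j, take i (w j)) < i" by blast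
    from place_cases[of n "w j" "fst (s j)" "\<tau> j", OF _ _ this] n len[of j]
    obtain l where "l \<in> {1..n}" "fst (s j) (\<tau> j, take l (w j)) + 1 = l"
      "\<forall>i\<in>{l<..n}. fst (s j) (\<tau> j, take i (w j)) + 1 < i"
      "place (\<tau> j) (w j) n (fst (s j)) = (?new j l, Some (\<tau> j l))"
      by auto
    then show ?thesis by (intro exI[of _ l]) (simp add: sSuc)
  qed
  have bound: "fst (s j) (t, p) < length p" if "p \<noteq> []" for j t p
    using that
  proof (induction j arbitrary: t p)
    case 0
    then show ?case by (simp add: s0)
  next
    case (Suc j)
    from step[OF Suc.IH] obtain l where l: "?step j l" by blast
    then have l': "\<forall>i\<in>{l<..n}. fst (s j) (\<tau> j, take i (w j)) + 1 < i"
      and "fst (s (Suc j)) = ?new j l" by simp_all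
    with Suc show ?case using len[of j] by auto
  qed
  then have "\<forall>j. \<exists>l. ?step j l" using step by blast
  then have "\<exists>lev. \<forall>j. ?step j (lev j)" by (rule choice)
  then obtain lev where "\<forall>j. ?step j (lev j)" by (rule exE)
  then have step_lev: "?step j (lev j)" for j by (rule spec)
  have lev: "lev j \<in> {1..n}" for j using step_lev[of j] by (rule conjunct1)
  have x_lev: "fst (s j) (\<tau> j, take (lev j) (w j)) + 1 = lev j" for j
    using step_lev[of j] by (elim conjE)
  have s_lev: "s (Suc j) = (?new j (lev j),
      (snd (s j))(\<tau> j (lev j) := insert (es ! j) (snd (s j) (\<tau> j (lev j)))))" for j
    using step_lev[of j] by (elim conjE)
  have x_Suc: "fst (s (Suc j)) = ?new j (lev j)" for j by (simp only: s_lev fst_conv)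
  have A_Suc: "snd (s (Suc j)) =
      (snd (s j))(\<tau> j (lev j) := insert (es ! j) (snd (s j) (\<tau> j (lev j))))" for j
    by (simp only: s_lev snd_conv)
  have A: "snd (s j) a = (!) es ` {i. i < j \<and> \<tau> i (lev i) = a}" for j a
    by (induction j) (auto simp: s0 A_Suc less_Suc_eq)
  \<comment> \<open>Arrivals at a key equal completed rounds times their length plus the current
    counter. As \<open>bound\<close> keeps the counter below \<open>length p\<close>, this is
    division with remainder.\<close>
  have count: "card {i. i < j \<and> \<tau> i = t \<and> take (length p) (w i) = p \<and> lev i \<le> length p} =
      length p * card {i. i < j \<and> \<tau> i = t \<and> take (length p) (w i) = p \<and> lev i = length p} +
      fst (s j) (t, p)" for j t p
  proof (induction j)
    case 0
    then show ?case by (simp add: s0)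
  next
    case (Suc j)
    show ?case
    proof (cases "\<tau> j = t \<and> take (length p) (w j) = p")
      case False
      then have "fst (s (Suc j)) (t, p) = fst (s j) (t, p)"
        using lev[of j] len[of j] by (auto simp: x_Suc)
      then show ?thesis using Suc False by (auto simp: card_less_Suc_if)
    next
      case True
      then have p: "length p \<le> n" using len[of j] by (metis length_take min.cobounded1)
      have eq: "(t, p) = (\<tau> j, take i (w j)) \<longleftrightarrow> i = length p" if "i \<le> n" for i
        using True that len[of j] by (metis length_take min.absorb2 prod.inject)
      have mem: "(t, p) \<in> (\<lambda>i. (\<tau> j, take i (w j))) ` {lev j<..n} \<longleftrightarrow> lev j < length p"
        using eq p by (auto simp: image_iff)
      have new: "fst (s (Suc j)) (t, p) = (if lev j = length p then 0
          else if lev j < length p then fst (s j) (t, p) + 1 else fst (s j) (t, p))"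
        using eq[of "lev j"] lev[of j] unfolding x_Suc mem by simp
      have "fst (s j) (t, p) + 1 = length p" if "lev j = length p"
        using x_lev[of j] True that by simp
      then show ?thesis using Suc True by (auto simp: card_less_Suc_if new)
    qed
  qed
  have "card {i. i < j \<and> \<tau> i = t \<and> take (length p) (w i) = p \<and> lev i = length p} =
      card {i. i < j \<and> \<tau> i = t \<and> take (length p) (w i) = p \<and> lev i \<le> length p} div length p"
    if "p \<noteq> []" for j t p
    unfolding count using bound[OF that] that by simp
  with lev A show thesis unfolding s_def by (rule that)
qed

text \<open>By downward induction on \<open>k\<close>: each class at level \<open>k + 1\<close> keeps at most a fraction
  \<open>1 / (k + 1)\<close> of the items reaching it, so at least a fraction \<open>k / (k + 1)\<close> moves on.\<close>

lemma card_reaching_level: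
  fixes key :: "nat \<Rightarrow> 'j \<Rightarrow> 'c"
  assumes fin: "finite J" and lev: "\<And>j. j \<in> J \<Longrightarrow> lev j \<le> n"
    and refine: "\<And>k i j. key (Suc k) i = key (Suc k) j \<Longrightarrow> key k i = key k j"
    and rounds: "\<And>k c. 1 \<le> k \<Longrightarrow> k \<le> n \<Longrightarrow>
      k * card {j\<in>J. key k j = c \<and> lev j = k} \<le> card {j\<in>J. key k j = c \<and> lev j \<le> k}"
    and "1 \<le> k" "k \<le> n"
  shows "k * card {j\<in>J. key k j = c} \<le> n * card {j\<in>J. key k j = c \<and> lev j \<le> k}"
  using \<open>k \<le> n\<close> \<open>1 \<le> k\<close>
proof (induction k arbitrary: c rule: inc_induct)
  case base
  have "{j\<in>J. key n j = c} = {j\<in>J. key n j = c \<and> lev j \<le> n}" using lev by auto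
  then show ?case by simp
next
  case (step k)
  \<comment> \<open>The classes one level up into which the class of \<open>c\<close> splits; the
    claim is proved for each of them and summed.\<close>
  define D where "D = key (Suc k) ` {j\<in>J. key k j = c}"
  have finD: "finite D" unfolding D_def using fin by simp
  have "{j\<in>J. key k j = c} = (\<Union>d\<in>D. {j\<in>J. key (Suc k) j = d})"
    unfolding D_def by (auto dest: refine)
  then have T: "card {j\<in>J. key k j = c} = (\<Sum>d\<in>D. card {j\<in>J. key (Suc k) j = d})"
    using finD fin by (simp only:) (rule card_UN_disjoint, auto)
  have "{j\<in>J. key k j = c \<and> lev j \<le> k} = (\<Union>d\<in>D. {j\<in>J. key (Suc k) j = d \<and> lev j \<le> k})"
    unfolding D_def by (auto dest: refine)
  then have R: "card {j\<in>J. key k j = c \<and> lev j \<le> k} =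
      (\<Sum>d\<in>D. card {j\<in>J. key (Suc k) j = d \<and> lev j \<le> k})"
    using finD fin by (simp only:) (rule card_UN_disjoint, auto)
  have "k * card {j\<in>J. key (Suc k) j = d} \<le> n * card {j\<in>J. key (Suc k) j = d \<and> lev j \<le> k}" for d
  proof -
    define t where "t = card {j\<in>J. key (Suc k) j = d}"
    define g where "g = card {j\<in>J. key (Suc k) j = d \<and> lev j = Suc k}"
    define r where "r = card {j\<in>J. key (Suc k) j = d \<and> lev j \<le> k}"
    have "{j\<in>J. key (Suc k) j = d \<and> lev j \<le> Suc k} =
        {j\<in>J. key (Suc k) j = d \<and> lev j = Suc k} \<union> {j\<in>J. key (Suc k) j = d \<and> lev j \<le> k}"
      by auto
    then have split: "card {j\<in>J. key (Suc k) j = d \<and> lev j \<le> Suc k} = g + r"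
      unfolding g_def r_def using fin by (simp only:) (rule card_Un_disjoint, auto)
    have 1: "Suc k * t \<le> n * (g + r)" using step.IH[of d] split by (simp add: t_def)
    have 2: "Suc k * g \<le> g + r"
      using rounds[of "Suc k" d] step.hyps split by (simp add: g_def)
    \<comment> \<open>Fact 2 amounts to \<open>k * g \<le> r\<close>, so
      \<open>k * (g + r) \<le> Suc k * r\<close>. Carrying the factor \<open>Suc k\<close> along and
      cancelling it last keeps the computation in the naturals.\<close>
    have "Suc k * (k * t) \<le> k * (n * (g + r))"
      using mult_left_mono[OF 1, of k] by (simp only: mult.left_commute)
    also have "\<dots> = n * (k * g + k * r)" by (simp add: algebra_simps)
    also have "\<dots> \<le> n * (Suc k * r)" using 2 by (intro mult_le_mono2) simp
    also have "\<dots> = Suc k * (n * r)" by (rule mult.left_commute)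
    finally have "k * t \<le> n * r" by (simp only: Suc_mult_le_cancel1)
    then show ?thesis by (simp add: t_def r_def)
  qed
  then show ?case unfolding T R sum_distrib_left by (rule sum_mono)
qed

section \<open>Geometric sums over sorted index sequences\<close>

lemma sum_power_le:
  fixes r :: real
  assumes "0 < r" "r < 1" "finite B" "\<And>b. b \<in> B \<Longrightarrow> a \<le> b"
  shows "(\<Sum>b\<in>B. r ^ b) \<le> r ^ a / (1 - r)"
proof -
  have s: "(\<lambda>b. r ^ a * r ^ b) sums (r ^ a * (1 / (1 - r)))"
    by (intro sums_mult geometric_sums) (use assms in auto)
  have "(\<Sum>b\<in>B. r ^ b) = (\<Sum>b\<in>(\<lambda>b. b - a) ` B. r ^ a * r ^ b)"
    using assms(4) by (subst sum.reindex) (auto simp: inj_on_def power_add[symmetric] eq_diff_iff)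
  also have "\<dots> \<le> (\<Sum>b. r ^ a * r ^ b)"
    by (rule sum_le_suminf) (use assms s in \<open>auto simp: sums_iff\<close>)
  also have "\<dots> = r ^ a / (1 - r)" using s by (simp add: sums_iff)
  finally show ?thesis .
qed

text \<open>Split off the first entry \<open>b\<close>: the remaining sequence is sorted and starts
  at \<open>b\<close> or later, so the induction hypothesis with \<open>b\<close> in place of
  \<open>a\<close> bounds its share by \<open>r ^ b / (1 - r) ^ Suc k\<close>. Summing over
  \<open>b \<ge> a\<close> contributes one more factor \<open>1 / (1 - r)\<close>. The lower bound
  on the head is what carries the induction.\<close>

lemma sum_power_last_sorted_le:
  fixes r :: real
  assumes r: "0 < r" "r < 1" and "finite P"
    and "\<And>p. p \<in> P \<Longrightarrow> length p = Suc k \<and> sorted p \<and> a \<le> hd p"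
  shows "(\<Sum>p\<in>P. r ^ last p) \<le> r ^ a / (1 - r) ^ Suc k"
  using assms(3,4)
proof (induction k arbitrary: P a)
  case 0
  have p: "\<exists>b\<ge>a. p = [b]" if "p \<in> P" for p
    using 0(2)[OF that] by (cases p) auto
  have "inj_on last P"
  proof (rule inj_onI)
    fix p q assume "p \<in> P" "q \<in> P" "last p = last q"
    with p[of p] p[of q] show "p = q" by auto
  qed
  then have "(\<Sum>p\<in>P. r ^ last p) = (\<Sum>b\<in>last ` P. r ^ b)"
    by (simp add: sum.reindex)
  also have "\<dots> \<le> r ^ a / (1 - r)"
  proof (rule sum_power_le[OF r])
    show "finite (last ` P)" using 0(1) by simp
    show "a \<le> b" if "b \<in> last ` P" for b
    proof -
      from that obtain q where "q \<in> P" "b = last q" by blast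
      with p[of q] show ?thesis by auto
    qed
  qed
  finally show ?case by simp
next
  case (Suc k)
  define S where "S b = {p. b # p \<in> P}" for b
  have S: "finite (S b)" for b
    using finite_vimageI[OF Suc.prems(1), of "(#) b"] by (simp add: S_def vimage_def)
  have shape: "\<exists>b q. p = b # q \<and> q \<in> S b \<and> length q = Suc k \<and> sorted q \<and> b \<le> hd q \<and> a \<le> b"
    if "p \<in> P" for p
  proof -
    have "length p = Suc (Suc k)" using Suc.prems(2)[OF that] by simp
    then obtain b c q where "p = b # c # q" by (metis length_Suc_conv)
    then show ?thesis using Suc.prems(2)[OF that] that by (auto simp: S_def)
  qed
  have P: "P = (\<lambda>(b, q). b # q) ` (SIGMA b:hd ` P. S b)"
  proof (intro equalityI subsetI)
    fix p assume "p \<in> P"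
    with shape[OF this] show "p \<in> (\<lambda>(b, q). b # q) ` (SIGMA b:hd ` P. S b)"
      by (force simp: image_iff)
  qed (auto simp: S_def)
  have "(\<Sum>p\<in>P. r ^ last p) = (\<Sum>(b, q)\<in>(SIGMA b:hd ` P. S b). r ^ last (b # q))"
    by (subst P, subst sum.reindex) (auto simp: inj_on_def split_beta)
  also have "\<dots> = (\<Sum>b\<in>hd ` P. \<Sum>q\<in>S b. r ^ last (b # q))"
    using Suc.prems(1) S by (subst sum.Sigma) auto
  also have "\<dots> \<le> (\<Sum>b\<in>hd ` P. r ^ b / (1 - r) ^ Suc k)"
  proof (rule sum_mono)
    fix b
    have q: "length q = Suc k \<and> sorted q \<and> b \<le> hd q" if "q \<in> S b" for q
      using shape[of "b # q"] that by (simp add: S_def)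
    have "r ^ last (b # x) = r ^ last x" if "x \<in> S b" for x
      using q[OF that] by (cases x) auto
    then have "(\<Sum>q\<in>S b. r ^ last (b # q)) = (\<Sum>q\<in>S b. r ^ last q)"
      by simp
    also have "\<dots> \<le> r ^ b / (1 - r) ^ Suc k" by (rule Suc.IH) (use S q in auto)
    finally show "(\<Sum>q\<in>S b. r ^ last (b # q)) \<le> r ^ b / (1 - r) ^ Suc k" .
  qed
  also have "\<dots> = (\<Sum>b\<in>hd ` P. r ^ b) / (1 - r) ^ Suc k" by (simp add: sum_divide_distrib)
  also have "\<dots> \<le> (r ^ a / (1 - r)) / (1 - r) ^ Suc k"
  proof (intro divide_right_mono sum_power_le r)
    show "a \<le> b" if "b \<in> hd ` P" for b using that shape by fastforce
  qed (use r Suc.prems(1) in auto)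
  finally show ?case by simp
qed

text \<open>The rounded value that an index stands for when \<open>r = 1 - \<epsilon>\<close>, with
  0 for \<open>Pinf\<close>. Finite indices of values in [0,1] are nonnegative, so
  \<open>nat\<close> loses nothing on them.\<close>

fun weight :: "real \<Rightarrow> int extended \<Rightarrow> real" where
  "weight r (Fin c) = r ^ nat c"
| "weight r _ = 0"

lemma weight_nonneg: "0 \<le> r \<Longrightarrow> 0 \<le> weight r x"
  by (cases x) auto

text \<open>Sequences ending in \<open>Pinf\<close> have weight 0 and drop out. In the others,
  sortedness makes every entry finite, so they embed injectively into sorted lists of naturals,
  where the geometric bound applies with \<open>a = 0\<close>.\<close>

lemma sum_weight_last_sorted_le:
  fixes r :: real
  assumes r: "0 < r" "r < 1" and "finite P" and k: "0 < k"
    and P: "\<And>p. p \<in> P \<Longrightarrow> length p = k \<and> sorted p \<and> (\<forall>c\<in>set p. Fin 0 \<le> c)"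
  shows "(\<Sum>p\<in>P. weight r (last p)) \<le> 1 / (1 - r) ^ k"
proof -
  \<comment> \<open>The value 0 at infinite entries is a mere default: by \<open>entries\<close>, no
    list in \<open>P'\<close> contains one.\<close>
  define f where "f = (\<lambda>x :: int extended. case x of Fin c \<Rightarrow> nat c | _ \<Rightarrow> 0)"
  define P' where "P' = {p\<in>P. last p \<noteq> Pinf}"
  have entries: "\<exists>a\<ge>0. c = Fin a" if "p \<in> P'" "c \<in> set p" for p c
  proof -
    have "p = butlast p @ [last p]" using that(2) by (cases p) simp_all
    then have "c \<le> last p" using P[of p] that
      by (metis (no_types, lifting) P'_def Un_iff empty_iff empty_set mem_Collect_eq order_refl
          set_ConsD set_append sorted_append list.set_intros(1))
    moreover have "Fin 0 \<le> c" "last p \<noteq> Pinf" using P[of p] that by (auto simp: P'_def)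
    ultimately show ?thesis by (cases c; cases "last p") auto
  qed
  have f_mono: "f x \<le> f y" if "x \<le> y" "p \<in> P'" "x \<in> set p" "y \<in> set p" for x y p
    using entries[OF that(2,3)] entries[OF that(2,4)] that(1) by (auto simp: f_def)
  have inj: "inj_on (map f) P'"
  proof (rule inj_onI)
    fix p q assume pq: "p \<in> P'" "q \<in> P'" "map f p = map f q"
    have "set p \<union> set q \<subseteq> Fin ` {0..}" using entries pq by blast
    moreover have "inj_on f (Fin ` {0..})" by (auto simp: inj_on_def f_def)
    ultimately show "p = q" using pq(3) map_inj_on inj_on_subset by blast
  qed
  have ne: "p \<noteq> []" if "p \<in> P'" for p using P[of p] that k by (auto simp: P'_def)
  have "(\<Sum>p\<in>P. weight r (last p)) = (\<Sum>p\<in>P'. weight r (last p))"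
    using \<open>finite P\<close> unfolding P'_def by (intro sum.mono_neutral_right) auto
  also have "\<dots> = (\<Sum>p\<in>P'. r ^ last (map f p))"
  proof (rule sum.cong)
    fix p assume p: "p \<in> P'"
    then obtain a where "last p = Fin a" using entries[OF p last_in_set[OF ne[OF p]]] by blast
    then show "weight r (last p) = r ^ last (map f p)"
      using ne[OF p] by (simp add: last_map f_def)
  qed simp
  also have "\<dots> = (\<Sum>q\<in>map f ` P'. r ^ last q)" using inj by (simp add: sum.reindex)
  also have "\<dots> \<le> r ^ 0 / (1 - r) ^ Suc (k - 1)"
  proof (rule sum_power_last_sorted_le[OF r])
    show "finite (map f ` P')" using \<open>finite P\<close> by (simp add: P'_def)
    fix q assume "q \<in> map f ` P'"
    then obtain p where p: "p \<in> P'" "q = map f p" by blast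
    then have "sorted_wrt (\<le>) p" "length p = k" using P[of p] by (auto simp: P'_def)
    then have "sorted_wrt (\<lambda>x y. f x \<le> f y) p"
      by (auto intro: sorted_wrt_mono_rel[rotated] f_mono[OF _ p(1)])
    with \<open>length p = k\<close> p k show "length q = Suc (k - 1) \<and> sorted q \<and> 0 \<le> hd q"
      by (simp add: sorted_map)
  qed
  finally show ?thesis using k by simp
qed

section \<open>Rounding of values by \<open>ind\<close>\<close>

text \<open>The base \<open>1 - \<epsilon>\<close> is below 1, so its logarithm is decreasing, and
  \<open>Pinf\<close> is the largest index. Hence descending values give nondecreasing index
  sequences.\<close>

lemma ind_antimono:
  assumes "0 < \<epsilon>" "\<epsilon> < 1" "0 \<le> x" "x \<le> y"
  shows "ind \<epsilon> y \<le> ind \<epsilon> x"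
proof (cases "x = 0")
  case True
  then show ?thesis by (simp add: ind_def)
next
  case False
  have "ln y / ln (1 - \<epsilon>) \<le> ln x / ln (1 - \<epsilon>)"
    using assms False by (intro divide_right_mono_neg) auto
  with False assms show ?thesis by (auto simp: ind_def log_def intro: floor_mono)
qed

lemma ind_nonneg:
  assumes "0 < \<epsilon>" "\<epsilon> < 1" "0 \<le> x" "x \<le> 1"
  shows "Fin 0 \<le> ind \<epsilon> x"
  using ind_antimono[of \<epsilon> x 1] assms by (simp add: ind_def zero_extended_def)

text \<open>With \<open>l\<close> the logarithm of \<open>x\<close>, this is
  \<open>\<lfloor>l\<rfloor> \<le> l \<le> \<lfloor>l\<rfloor> + 1\<close> under the decreasing map
  \<open>(1 - \<epsilon>) powr _\<close>.\<close>

lemma weight_ind_bounds: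
  assumes "0 < \<epsilon>" "\<epsilon> < 1" "0 \<le> x" "x \<le> 1"
  shows "x \<le> weight (1 - \<epsilon>) (ind \<epsilon> x)" "(1 - \<epsilon>) * weight (1 - \<epsilon>) (ind \<epsilon> x) \<le> x"
proof -
  let ?r = "1 - \<epsilon>"
  have "x \<le> weight ?r (ind \<epsilon> x) \<and> ?r * weight ?r (ind \<epsilon> x) \<le> x"
  proof (cases "x = 0")
    case True
    then show ?thesis by (simp add: ind_def)
  next
    case False
    define l where "l = log ?r x"
    have x: "?r powr l = x" using assms False by (simp add: l_def)
    have "0 \<le> \<lfloor>l\<rfloor>" using ind_nonneg[OF assms] False by (simp add: ind_def l_def)
    then have p: "?r ^ nat \<lfloor>l\<rfloor> = ?r powr \<lfloor>l\<rfloor>" "?r * ?r ^ nat \<lfloor>l\<rfloor> = ?r powr (\<lfloor>l\<rfloor> + 1)"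
      using assms by (simp_all add: powr_real_of_int' powr_add powr_realpow[symmetric])
    have "?r powr l \<le> ?r powr \<lfloor>l\<rfloor>" by (rule powr_mono') (use assms in auto)
    moreover have "?r powr (\<lfloor>l\<rfloor> + 1) \<le> ?r powr l" by (rule powr_mono') (use assms in linarith)+
    ultimately show ?thesis using p x False by (simp add: ind_def l_def)
  qed
  then show "x \<le> weight ?r (ind \<epsilon> x)" "?r * weight ?r (ind \<epsilon> x) \<le> x" by simp_all
qed

theorem theorem3:
  fixes n :: nat and \<epsilon> :: real
    and tb :: "(nat \<Rightarrow> real) list \<Rightarrow> nat \<Rightarrow> nat"
    and v :: "nat \<Rightarrow> 'e \<Rightarrow> real" and es :: "'e list"
  assumes "n \<ge> 1" and "0 < \<epsilon>" and "\<epsilon> < 1"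
    and "tie_breaking n tb"
    and "distinct es"
    and "\<And>i e. i \<in> {1..n} \<Longrightarrow> e \<in> set es \<Longrightarrow> 0 \<le> v i e \<and> v i e \<le> 1"
  defines "A \<equiv> alg n \<epsilon> tb v es"
  shows "allocation n (set es) A \<and>
    (\<forall>i\<in>{1..n}. bundle_value (v i) (A i)
       \<ge> (1 - \<epsilon>) / real n * bundle_value (v i) (set es) - (fact n)\<^sup>2 / \<epsilon> ^ n)"
proof -

  \<comment> \<open>Item indices, sorted index sequences, and the levels of the items\<close>
  define J where "J = {..<length es}"
  define T where "T j = tb (map (\<lambda>e i. v i e) (take (Suc j) es))" for j
  define W where "W j = map (\<lambda>i. ind \<epsilon> (v (T j i) (es ! j))) [1..<Suc n]" for j
  \<comment> \<open>The counter that item \<open>j\<close> meets at level \<open>k\<close> if it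
    gets that far.\<close>
  define key where "key k j = (T j, take k (W j))" for k j
  have finJ: "finite J" by (simp add: J_def)
  have inj: "inj_on ((!) es) J" using \<open>distinct es\<close> by (simp add: J_def inj_on_nth)
  have set_es: "set es = (!) es ` J" by (auto simp: J_def set_conv_nth)
  have val: "0 \<le> v i (es ! j) \<and> v i (es ! j) \<le> 1" if "i \<in> {1..n}" "j \<in> J" for i j
    using assms(6) that by (simp add: J_def)
  have "sorts n (\<lambda>i. v i (es ! j)) (T j)" if j: "j \<in> J" for j
  proof -
    let ?us = "map (\<lambda>e i. v i e) (take (Suc j) es)"
    have us: "?us \<noteq> []" "last ?us = (\<lambda>i. v i (es ! j))"
      using j by (auto simp: J_def last_map take_Suc_conv_app_nth)
    then have "sorts n (last ?us) (tb ?us)"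
      using \<open>tie_breaking n tb\<close> val[OF _ j] unfolding tie_breaking_def by (metis (no_types, lifting))
    then show ?thesis unfolding us(2) T_def .
  qed
  then have perm: "T j permutes {1..n}"
    and mono: "i \<in> {1..n} \<Longrightarrow> i' \<in> {1..n} \<Longrightarrow> i \<le> i' \<Longrightarrow> v (T j i') (es ! j) \<le> v (T j i) (es ! j)"
    if "j \<in> J" for i i' j
    using that unfolding sorts_def by blast+
  have T_range: "T j i \<in> {1..n}" if "j \<in> J" "i \<in> {1..n}" for i j
    using permutes_in_image[OF perm] that by blast
  have len: "length (W j) = n" for j by (simp add: W_def)
  have W_nth: "W j ! i = ind \<epsilon> (v (T j (Suc i)) (es ! j))" if "i < n" for i j
    using that by (simp add: W_def del: upt_Suc)
  have W_nonneg: "Fin 0 \<le> c" if "j \<in> J" "c \<in> set (W j)" for c j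
  proof -
    have "set (W j) = (\<lambda>i. ind \<epsilon> (v (T j i) (es ! j))) ` {1..n}"
      by (simp add: W_def atLeastLessThanSuc_atLeastAtMost del: upt_Suc)
    with that(2) obtain i where "i \<in> {1..n}" "c = ind \<epsilon> (v (T j i) (es ! j))"
      by blast
    then show ?thesis using ind_nonneg[OF assms(2,3)] val[OF T_range[OF that(1)] that(1)] by simp
  qed
  have W_sorted: "sorted (W j)" if "j \<in> J" for j
    unfolding sorted_iff_nth_mono len
  proof (intro allI impI)
    fix i i' assume "i \<le> i'" "i' < n"
    then show "W j ! i \<le> W j ! i'"
      using mono[OF that, of "Suc i" "Suc i'"] val[OF T_range[OF that, of "Suc i'"] that]
      by (simp add: W_nth ind_antimono[OF assms(2,3)])
  qed
  obtain lev where lev: "\<And>j. lev j \<in> {1..n}"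
    and A: "\<And>a. A a = (!) es ` {j\<in>J. T j (lev j) = a}"
    and rounds: "\<And>t p. p \<noteq> [] \<Longrightarrow> card {j\<in>J. key (length p) j = (t, p) \<and> lev j = length p} =
      card {j\<in>J. key (length p) j = (t, p) \<and> lev j \<le> length p} div length p"
  proof (rule state_after_levels[of T tb v es W \<epsilon> n, OF T_def W_def \<open>n \<ge> 1\<close>])
    fix lev
    assume 1: "\<And>j. lev j \<in> {1..n}"
      and 2: "\<And>j a. snd (state_after n \<epsilon> tb v es j) a = (!) es ` {i. i < j \<and> T i (lev i) = a}"
      and 3: "\<And>j t p. p \<noteq> [] \<Longrightarrow>
        card {i. i < j \<and> T i = t \<and> take (length p) (W i) = p \<and> lev i = length p} =
        card {i. i < j \<and> T i = t \<and> take (length p) (W i) = p \<and> lev i \<le> length p} div length p"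
    show thesis
    proof (rule that[of lev])
      show "A a = (!) es ` {j\<in>J. T j (lev j) = a}" for a
        unfolding A_def alg_def 2 J_def by simp
      show "card {j\<in>J. key (length p) j = (t, p) \<and> lev j = length p} =
          card {j\<in>J. key (length p) j = (t, p) \<and> lev j \<le> length p} div length p"
        if "p \<noteq> []" for t p
        using 3[OF that, of "length es" t]
        by (simp only: key_def J_def prod.inject lessThan_iff conj_assoc)
    qed (rule 1)
  qed
  have reach: "k * card {j\<in>J. key k j = c} \<le> n * card {j\<in>J. key k j = c \<and> lev j \<le> k}"
    if k: "1 \<le> k" "k \<le> n" for k c
  proof (rule card_reaching_level[OF finJ _ _ _ k])
    show "lev j \<le> n" for j using lev by simp
    show "key k i = key k j" if "key (Suc k) i = key (Suc k) j" for k i j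
    proof -
      have "take k (take (Suc k) (W i)) = take k (take (Suc k) (W j))"
        using that by (simp add: key_def)
      then show ?thesis using that by (simp add: key_def min_def)
    qed
    show "k * card {j\<in>J. key k j = c \<and> lev j = k} \<le> card {j\<in>J. key k j = c \<and> lev j \<le> k}"
      if "1 \<le> k" "k \<le> n" for k c
    \<comment> \<open>\<open>rounds\<close> speaks of prefixes of length \<open>k\<close> only; any
      other pair is the level \<open>k\<close> key of no item, since
      \<open>k \<le> n\<close>.\<close>
    proof (cases "length (snd c) = k")
      case True
      then have "snd c \<noteq> []" using that by auto
      from rounds[OF this, of "fst c"] True show ?thesis by simp
    next
      case False
      then have "{j\<in>J. key k j = c \<and> lev j = k} = {}" using that len by (auto simp: key_def)
      then show ?thesis by (simp only:) simp
    qed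
  qed

  \<comment> \<open>The output is an allocation\<close>
  have "allocation n (set es) A"
  proof -
    have "disjoint_family_on A {1..n}"
      using inj_onD[OF inj] by (fastforce simp: disjoint_family_on_def A)
    moreover have "(\<Union>i\<in>{1..n}. A i) = set es"
    proof (intro equalityI subsetI)
      fix e assume "e \<in> set es"
      then obtain j where "j \<in> J" "e = es ! j" by (auto simp: set_es)
      then have "e \<in> A (T j (lev j))" "T j (lev j) \<in> {1..n}" using T_range lev by (auto simp: A)
      then show "e \<in> (\<Union>i\<in>{1..n}. A i)" by blast
    qed (auto simp: A set_es)
    ultimately show ?thesis by (simp add: allocation_def)
  qed

  \<comment> \<open>The guarantee for a single agent\<close>
  moreover have "(1 - \<epsilon>) / real n * bundle_value (v a) (set es) - (fact n)\<^sup>2 / \<epsilon> ^ n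
      \<le> bundle_value (v a) (A a)" if a: "a \<in> {1..n}" for a
  proof -
    define pos where "pos j = inv (T j) a" for j
    \<comment> \<open>Cutting at the position of \<open>a\<close> makes the index of
      \<open>a\<close> the last entry, so the class determines both the position and the rounded
      value of \<open>a\<close>.\<close>
    define cls where "cls j = key (pos j) j" for j
    define u where "u j = v a (es ! j)" for j
    define wt where "wt q = weight (1 - \<epsilon>) (last (snd q))" for q :: "(nat \<Rightarrow> nat) \<times> int extended list"
    have pos: "pos j \<in> {1..n}" and T_pos: "T j i = a \<longleftrightarrow> i = pos j" if "j \<in> J" for i j
      using permutes_in_image[OF permutes_inv[OF perm[OF that]]] a
        permutes_inv_eq[OF perm[OF that], of a i] by (auto simp: pos_def)
    have bounds: "u j \<le> wt (cls j)" "(1 - \<epsilon>) * wt (cls j) \<le> u j" if "j \<in> J" for j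
    proof -
      have "last (take (pos j) (W j)) = W j ! (pos j - 1)"
        using pos[OF that] len[of j] by (subst last_conv_nth) auto
      also have "\<dots> = ind \<epsilon> (u j)"
        using pos[OF that] T_pos[OF that, of "pos j"] by (subst W_nth) (auto simp: u_def)
      finally have "wt (cls j) = weight (1 - \<epsilon>) (ind \<epsilon> (u j))"
        by (simp add: wt_def cls_def key_def)
      then show "u j \<le> wt (cls j)" "(1 - \<epsilon>) * wt (cls j) \<le> u j"
        using weight_ind_bounds[OF assms(2,3)] val[OF a that] by (simp_all add: u_def)
    qed
    have wt_nonneg: "0 \<le> wt q" for q using assms(3) by (simp add: wt_def weight_nonneg)
    have class_bound: "(1 - \<epsilon>) / n * (\<Sum>j\<in>{j\<in>J. cls j = q}. u j) - wt q
        \<le> (\<Sum>j\<in>{j\<in>{j\<in>J. lev j = pos j}. cls j = q}. u j)" if q: "q \<in> cls ` J" for q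
    proof -
      define k where "k = length (snd q)"
      define F where "F = {j\<in>J. cls j = q}"
      define G where "G = {j\<in>{j\<in>J. lev j = pos j}. cls j = q}"
      from q obtain i where i: "i \<in> J" "q = cls i" by blast
      then have ki: "k = pos i" using pos[of i] len[of i] by (simp add: k_def cls_def key_def)
      have pos_k: "pos j = k" if "fst q = T j" for j
        using that i ki by (simp add: pos_def cls_def key_def)
      have F: "F = {j\<in>J. key k j = q}"
        unfolding F_def cls_def using pos_k by (auto simp: key_def)
      have G: "G = {j\<in>J. key k j = q \<and> lev j = k}"
        unfolding G_def cls_def using pos_k by (auto simp: key_def)
      define R where "R = card {j\<in>J. key k j = q \<and> lev j \<le> k}"
      have k: "1 \<le> k" "k \<le> n" using pos[OF i(1)] ki by auto
      then have "snd q \<noteq> []" by (auto simp: k_def)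
      from rounds[OF this, of "fst q"] have "card G = R div k" by (simp add: G R_def k_def)
      \<comment> \<open>Only the last, unfinished round is lost. Combined with \<open>reach\<close>,
        the factor \<open>k\<close> cancels and \<open>a\<close> gets at least
        \<open>card F / n - 1\<close> items of the class.\<close>
      then have "R < k * (card G + 1)"
        using k(1) by (metis Suc_eq_plus1 dividend_less_times_div less_le_trans mult_Suc_right
            zero_less_one add.commute)
      moreover have "k * card F \<le> n * R" using reach[OF k] by (simp add: F R_def)
      ultimately have "k * card F \<le> n * (k * (card G + 1))"
        by (meson less_imp_le_nat mult_le_mono2 order_trans)
      then have "k * card F \<le> k * (n * (card G + 1))" by (simp only: mult.left_commute)
      then have "card F \<le> n * (card G + 1)" using k(1) by simp
      then have "real (card F) \<le> real n * (card G + 1)"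
        by (metis of_nat_Suc of_nat_le_iff of_nat_mult Suc_eq_plus1)
      then have card: "card F / n - 1 \<le> card G" using \<open>n \<ge> 1\<close> by (simp add: field_simps)
      have "(\<Sum>j\<in>F. u j) \<le> card F * wt q"
        by (rule sum_bounded_above) (use bounds in \<open>auto simp: F_def\<close>)
      then have "(1 - \<epsilon>) / n * (\<Sum>j\<in>F. u j) \<le> (1 - \<epsilon>) / n * (card F * wt q)"
        using assms(3) by (intro mult_left_mono) auto
      \<comment> \<open>The missing item costs \<open>(1 - \<epsilon>) * wt q\<close>, which is
        rounded up to \<open>wt q\<close>.\<close>
      moreover have "(1 - \<epsilon>) * wt q \<le> wt q"
        using wt_nonneg[of q] assms(2,3) by (simp add: mult_left_le_one_le)
      moreover have "(card F / n - 1) * ((1 - \<epsilon>) * wt q) =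
          (1 - \<epsilon>) / n * (card F * wt q) - (1 - \<epsilon>) * wt q"
        by (simp add: algebra_simps diff_divide_distrib)
      ultimately have "(1 - \<epsilon>) / n * (\<Sum>j\<in>F. u j) - wt q \<le> (card F / n - 1) * ((1 - \<epsilon>) * wt q)"
        by linarith
      also have "\<dots> \<le> card G * ((1 - \<epsilon>) * wt q)"
        using card assms(3) wt_nonneg by (intro mult_right_mono) auto
      also have "\<dots> \<le> (\<Sum>j\<in>G. u j)"
        by (rule sum_bounded_below) (use bounds in \<open>auto simp: G_def\<close>)
      finally show ?thesis by (simp add: F_def G_def)
    qed
    \<comment> \<open>For a fixed permutation \<open>t\<close>, all classes have prefixes of the
      same length \<open>inv t a \<le> n\<close>, so their weights sum to at most
      \<open>1 / \<epsilon> ^ n\<close>; there are \<open>fact n\<close> permutations.\<close>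
    have wt_sum: "(\<Sum>q\<in>cls ` J. wt q) \<le> fact n / \<epsilon> ^ n"
    proof -
      define S where "S = {t. t permutes {1..n}}"
      have finS: "finite S" by (simp add: S_def finite_permutations)
      have cardS: "card S = fact n" using card_permutations[of "{1..n}" n] by (simp add: S_def)
      have "fst ` cls ` J \<subseteq> S" using perm by (auto simp: S_def cls_def key_def)
      then have "(\<Sum>q\<in>cls ` J. wt q) = (\<Sum>t\<in>S. \<Sum>q\<in>{q\<in>cls ` J. fst q = t}. wt q)"
        using finJ finS by (intro sum.group[symmetric]) auto
      also have "\<dots> \<le> (\<Sum>t\<in>S. 1 / \<epsilon> ^ n)"
      proof (rule sum_mono)
        fix t assume "t \<in> S"
        then have k: "inv t a \<in> {1..n}"
          using permutes_in_image[OF permutes_inv, of t "{1..n}" a] a by (simp add: S_def)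
        let ?D = "{q\<in>cls ` J. fst q = t}"
        have "(\<Sum>q\<in>?D. wt q) = (\<Sum>p\<in>snd ` ?D. weight (1 - \<epsilon>) (last p))"
          by (subst sum.reindex) (auto simp: inj_on_def wt_def)
        also have "\<dots> \<le> 1 / (1 - (1 - \<epsilon>)) ^ inv t a"
        proof (rule sum_weight_last_sorted_le)
          fix p assume "p \<in> snd ` ?D"
          then obtain j where "j \<in> J" "T j = t" "p = take (pos j) (W j)"
            by (auto simp: cls_def key_def)
          then show "length p = inv t a \<and> sorted p \<and> (\<forall>c\<in>set p. Fin 0 \<le> c)"
            using k len[of j] W_sorted W_nonneg by (auto simp: pos_def sorted_wrt_take dest: in_set_takeD)
        qed (use k assms(2,3) finJ in auto)
        also have "\<dots> \<le> 1 / \<epsilon> ^ n"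
          using k assms(2,3) by (auto intro!: divide_left_mono power_decreasing)
        finally show "(\<Sum>q\<in>?D. wt q) \<le> 1 / \<epsilon> ^ n" .
      qed
      also have "\<dots> = fact n / \<epsilon> ^ n" by (simp add: cardS)
      finally show ?thesis .
    qed
    have "bundle_value (v a) (set es) = (\<Sum>j\<in>J. u j)"
      unfolding bundle_value_def set_es using inj by (simp add: sum.reindex u_def)
    also have "\<dots> = (\<Sum>q\<in>cls ` J. \<Sum>j\<in>{j\<in>J. cls j = q}. u j)"
      using finJ by (intro sum.group[symmetric]) auto
    finally have total: "bundle_value (v a) (set es) = (\<Sum>q\<in>cls ` J. \<Sum>j\<in>{j\<in>J. cls j = q}. u j)" .
    \<comment> \<open>Agent \<open>a\<close> receives exactly the items that stop at the level of
      its own position.\<close>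
    have "{j\<in>J. T j (lev j) = a} = {j\<in>J. lev j = pos j}" using T_pos by blast
    moreover have "inj_on ((!) es) {j\<in>J. lev j = pos j}" using inj by (rule inj_on_subset) auto
    ultimately have "bundle_value (v a) (A a) = (\<Sum>j\<in>{j\<in>J. lev j = pos j}. u j)"
      unfolding bundle_value_def A by (simp add: sum.reindex u_def)
    also have "\<dots> = (\<Sum>q\<in>cls ` J. \<Sum>j\<in>{j\<in>{j\<in>J. lev j = pos j}. cls j = q}. u j)"
      using finJ by (intro sum.group[symmetric]) auto
    finally have received: "bundle_value (v a) (A a) =
      (\<Sum>q\<in>cls ` J. \<Sum>j\<in>{j\<in>{j\<in>J. lev j = pos j}. cls j = q}. u j)" .
    have "(1 - \<epsilon>) / n * bundle_value (v a) (set es) - (\<Sum>q\<in>cls ` J. wt q) =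
        (\<Sum>q\<in>cls ` J. (1 - \<epsilon>) / n * (\<Sum>j\<in>{j\<in>J. cls j = q}. u j) - wt q)"
      unfolding total by (simp only: sum_subtractf sum_distrib_left)
    also have "\<dots> \<le> bundle_value (v a) (A a)"
      unfolding received by (rule sum_mono) (rule class_bound)
    finally have "(1 - \<epsilon>) / n * bundle_value (v a) (set es) - fact n / \<epsilon> ^ n \<le> bundle_value (v a) (A a)"
      using wt_sum by linarith
    \<comment> \<open>The loss obtained has a single factor \<open>fact n\<close>; squaring it only
      weakens the bound.\<close>
    moreover have "fact n / \<epsilon> ^ n \<le> (fact n)\<^sup>2 / \<epsilon> ^ n"
      using assms(2) fact_ge_1[of n, where 'a = real]
      by (intro divide_right_mono) (auto simp: power2_eq_square)
    ultimately show ?thesis by linarith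
  qed
  ultimately show ?thesis by blast
qed

end
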